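(* Let $a>0$ be a real number. Let $L_a:\mathbb{R}^3\to\mathbb{R}^3$ be the invertible linear map with matrix $$[a]=\begin{pmatrix}1&0&a/2\\0&2&0\\0&0&-a/2\end{pmatrix},$$ so that $(\alpha,\beta,\gamma)=L_a(u,\theta,\phi)=\left(u+\tfrac a2\phi,\;2\theta,\;-\tfrac a2\phi\right)$. Put $F_a=\mathrm{id}\times L_a:(t,u,\theta,\phi)\mapsto (t,L_a(u,\theta,\phi))$, regarded as a map from the $(t,u,\theta,\phi)$-space $(\mathbb{R}\setminus\{0\})\times\mathbb{R}^3$ to the $(t,\alpha,\beta,\gamma)$-space $(\mathbb{R}\setminus\{0\})\times\mathbb{R}^3$. Let $$\boldsymbol{\alpha}=d\alpha+\cos\beta\,d\gamma,\qquad \lambda=du+a\sin^2\theta\,d\phi,\qquad \eta=t^{-1}dt,$$ $$\omega_{\mathbb{U}^{\mathrm{ab}}(2)}=d\boldsymbol{\alpha}+\boldsymbol{\alpha}\wedge\eta,\qquad \omega_{\mathrm{Kerr}^+}=d\lambda+\lambda\wedge\eta .$$ Then $$\lambda=F_a^*\,\boldsymbol{\alpha}\qquad\text{and}\qquad \omega_{\mathrm{Kerr}^+}=F_a^*\,\omega_{\mathbb{U}^{\mathrm{ab}}(2)} .$$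
   Context: $(u,\theta,\phi)$ together with $t$ are Kerr coordinates, with $\phi$ taken to be real-valued rather than periodic, on the cover $\mathrm{Kerr}^+$ of Kerr space-time; $a$ is the rotation parameter. $(\alpha,\beta,\gamma)$ are Euler-angle coordinates for $\mathrm{SU}(2)$ and $t$ is the coordinate on the factor $\mathbb{R}$ of $\mathbb{U}^{\mathrm{ab}}(2)\cong\mathbb{R}\times \mathrm{SU}(2)$, the universal cover of $\mathrm{U}(2)$; here everything is expressed on the coordinate space $\mathbb{R}\times\mathbb{R}^3$ of these coordinates. The one-form $\eta$ on both sides is given by the same expression $t^{-1}dt$. The upper star denotes pullback of differential forms. *)

theory Defs
  imports "HOL-Analysis.Analysis"
begin

text \<open>
  Differential forms of degree 1 and 2 on (open subsets of) a normed space: a 1-form assigns to a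
  point a linear functional on tangent vectors, a 2-form an alternating bilinear one. Linearity is
  not part of the types. Normalisation: no factor 1/2 in the wedge product or in the exterior
  derivative, so that \<open>(dx \<and> dy)(v, w) = dx(v) dy(w) - dx(w) dy(v)\<close> and \<open>d(f dx) = df \<and> dx\<close>.
\<close>

type_synonym 'a one_form = "'a \<Rightarrow> 'a \<Rightarrow> real"
type_synonym 'a two_form = "'a \<Rightarrow> 'a \<Rightarrow> 'a \<Rightarrow> real"

definition ext_d0 :: "('a::real_normed_vector \<Rightarrow> real) \<Rightarrow> 'a one_form" where
  "ext_d0 f = (\<lambda>p v. frechet_derivative f (at p) v)"

text \<open>In the next formula \<open>v\<close> and \<open>w\<close> are constant vector fields, so the bracket term
  of the invariant formula for the exterior derivative vanishes.\<close>

definition ext_d1 :: "('a::real_normed_vector) one_form \<Rightarrow> 'a two_form" where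
  "ext_d1 \<omega> = (\<lambda>p v w. frechet_derivative (\<lambda>q. \<omega> q w) (at p) v
                     - frechet_derivative (\<lambda>q. \<omega> q v) (at p) w)"

definition wedge :: "'a one_form \<Rightarrow> 'a one_form \<Rightarrow> 'a two_form" where
  "wedge \<mu> \<nu> = (\<lambda>p v w. \<mu> p v * \<nu> p w - \<mu> p w * \<nu> p v)"

definition pullback1 ::
  "('a::real_normed_vector \<Rightarrow> 'b::real_normed_vector) \<Rightarrow> 'b one_form \<Rightarrow> 'a one_form" where
  "pullback1 F \<omega> = (\<lambda>p v. \<omega> (F p) (frechet_derivative F (at p) v))"

definition pullback2 ::
  "('a::real_normed_vector \<Rightarrow> 'b::real_normed_vector) \<Rightarrow> 'b two_form \<Rightarrow> 'a two_form" where
  "pullback2 F \<omega> = (\<lambda>p v w. \<omega> (F p) (frechet_derivative F (at p) v) (frechet_derivative F (at p) w))"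

text \<open>The coordinate space, used both for \<open>(t, u, \<theta>, \<phi>)\<close> and for \<open>(t, \<alpha>, \<beta>, \<gamma>)\<close>.\<close>

type_synonym coords = "real \<times> (real ^ 3)"

definition coord_domain :: "coords set" where
  "coord_domain = (UNIV - {0}) \<times> UNIV"

definition t_coord :: "coords \<Rightarrow> real" where "t_coord p = fst p"

definition u_coord :: "coords \<Rightarrow> real" where "u_coord p = snd p $ 1"
definition theta_coord :: "coords \<Rightarrow> real" where "theta_coord p = snd p $ 2"
definition phi_coord :: "coords \<Rightarrow> real" where "phi_coord p = snd p $ 3"

definition alpha_coord :: "coords \<Rightarrow> real" where "alpha_coord p = snd p $ 1"
definition beta_coord :: "coords \<Rightarrow> real" where "beta_coord p = snd p $ 2"
definition gamma_coord :: "coords \<Rightarrow> real" where "gamma_coord p = snd p $ 3"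

definition L_matrix :: "real \<Rightarrow> real ^ 3 ^ 3" where
  "L_matrix a = vector [vector [1, 0, a / 2],
                        vector [0, 2, 0],
                        vector [0, 0, - (a / 2)]]"

definition L_map :: "real \<Rightarrow> real ^ 3 \<Rightarrow> real ^ 3" where
  "L_map a x = L_matrix a *v x"

definition F_map :: "real \<Rightarrow> coords \<Rightarrow> coords" where
  "F_map a = map_prod id (L_map a)"

definition eta_form :: "coords one_form" where
  "eta_form = (\<lambda>p v. inverse (t_coord p) * ext_d0 t_coord p v)"

definition alpha_form :: "coords one_form" where
  "alpha_form = (\<lambda>p v. ext_d0 alpha_coord p v + cos (beta_coord p) * ext_d0 gamma_coord p v)"

definition lambda_form :: "real \<Rightarrow> coords one_form" where
  "lambda_form a = (\<lambda>p v. ext_d0 u_coord p v + a * (sin (theta_coord p))\<^sup>2 * ext_d0 phi_coord p v)"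

definition omega_U2 :: "coords two_form" where
  "omega_U2 = (\<lambda>p v w. ext_d1 alpha_form p v w + wedge alpha_form eta_form p v w)"

definition omega_Kerr :: "real \<Rightarrow> coords two_form" where
  "omega_Kerr a = (\<lambda>p v w. ext_d1 (lambda_form a) p v w + wedge (lambda_form a) eta_form p v w)"

lemma L_map_vector:
  "L_map a (vector [u, \<theta>, \<phi>]) = vector [u + a / 2 * \<phi>, 2 * \<theta>, - (a / 2) * \<phi>]"
  by (simp add: L_map_def L_matrix_def matrix_vector_mult_def vec_eq_iff sum_3 forall_3)

lemma invertible_L_matrix: "a > 0 \<Longrightarrow> invertible (L_matrix a)"
  by (simp add: invertible_det_nz det_3 L_matrix_def)

lemma open_coord_domain: "open coord_domain"
  unfolding coord_domain_def by (intro open_Times open_Diff) auto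

lemma F_map_coord_domain: "F_map a ` coord_domain \<subseteq> coord_domain"
  by (auto simp: coord_domain_def F_map_def)

end

theory Submission
  imports Defs
begin

text \<open>
  Since \<open>1 - cos (2 * \<theta>) = 2 * (sin \<theta>)\<^sup>2\<close>, substituting \<open>L_a\<close> into \<open>d\<alpha> + cos \<beta> d\<gamma>\<close> gives \<open>\<lambda>\<close>.
  The map \<open>F_a\<close> fixes \<open>t\<close>, hence \<open>\<eta>\<close>, so the identity for the two-forms follows by naturality of
  the exterior derivative and the wedge product. As \<open>F_a\<close> is linear, naturality of the exterior
  derivative is just the chain rule: no second derivative of \<open>F_a\<close> appears.
\<close>

lemma frechet_derivative_bounded_linear:
  "bounded_linear f \<Longrightarrow> frechet_derivative f (at p) = f"
  by (metis bounded_linear_imp_has_derivative frechet_derivative_at)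

lemma ext_d0_bounded_linear: "bounded_linear f \<Longrightarrow> ext_d0 f p = f"
  by (simp add: ext_d0_def frechet_derivative_bounded_linear)

lemma pullback1_bounded_linear:
  "bounded_linear F \<Longrightarrow> pullback1 F \<omega> = (\<lambda>p v. \<omega> (F p) (F v))"
  by (simp add: pullback1_def frechet_derivative_bounded_linear)

lemma pullback2_bounded_linear:
  "bounded_linear F \<Longrightarrow> pullback2 F \<omega> = (\<lambda>p v w. \<omega> (F p) (F v) (F w))"
  by (simp add: pullback2_def frechet_derivative_bounded_linear)

lemma pullback2_wedge: "pullback2 F (wedge \<mu> \<nu>) = wedge (pullback1 F \<mu>) (pullback1 F \<nu>)"
  by (simp add: pullback2_def pullback1_def wedge_def)

text \<open>\<open>frechet_derivative\<close> is a choice operator, so the chain rule at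
  \<open>F p\<close> needs the coefficients of \<open>\<omega>\<close> to be differentiable
  there.\<close>

lemma pullback2_ext_d1:
  assumes F: "bounded_linear F" and \<omega>: "\<And>w. (\<lambda>q. \<omega> q w) differentiable at (F p)"
  shows "pullback2 F (ext_d1 \<omega>) p = ext_d1 (pullback1 F \<omega>) p"
proof -
  \<comment> \<open>The linear \<open>F\<close> carries the constant field \<open>w\<close> to the
    constant field \<open>F w\<close>, so only the base point varies.\<close>
  have "frechet_derivative (\<lambda>q. \<omega> (F q) (F w)) (at p) v
      = frechet_derivative (\<lambda>q. \<omega> q (F w)) (at (F p)) (F v)" for v w
    using frechet_derivative_compose[OF bounded_linear_imp_differentiable[OF F] \<omega>]
    by (simp add: o_def frechet_derivative_bounded_linear[OF F])
  then show ?thesis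
    by (simp add: ext_d1_def pullback1_bounded_linear[OF F] pullback2_bounded_linear[OF F])
qed

lemma bounded_linear_snd_nth: "bounded_linear (\<lambda>p::coords. snd p $ i)"
  by (intro bounded_linear_compose[OF bounded_linear_vec_nth] bounded_linear_snd)

lemma bounded_linear_F_map: "bounded_linear (F_map a)"
proof -
  have "F_map a = (\<lambda>p. (fst p, L_matrix a *v snd p))"
    by (auto simp: F_map_def L_map_def)
  then show ?thesis
    by (auto intro!: bounded_linear_Pair bounded_linear_fst bounded_linear_snd
        bounded_linear_compose[OF matrix_vector_mul_bounded_linear])
qed

lemma F_map_components:
  "fst (F_map a p) = fst p"
  "snd (F_map a p) $ 1 = snd p $ 1 + a / 2 * snd p $ 3"
  "snd (F_map a p) $ 2 = 2 * snd p $ 2"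
  "snd (F_map a p) $ 3 = - (a / 2) * snd p $ 3"
  by (simp_all add: F_map_def L_map_def L_matrix_def matrix_vector_mult_def sum_3)

text \<open>A linear coordinate is its own differential at every point, which turns the forms into
  explicit component formulas.\<close>

lemma eta_form_eq: "eta_form = (\<lambda>p v. inverse (fst p) * fst v)"
  by (simp add: eta_form_def t_coord_def[abs_def] ext_d0_bounded_linear bounded_linear_fst)

lemma alpha_form_eq: "alpha_form = (\<lambda>p v. snd v $ 1 + cos (snd p $ 2) * snd v $ 3)"
  by (simp add: alpha_form_def alpha_coord_def[abs_def] beta_coord_def gamma_coord_def[abs_def]
      ext_d0_bounded_linear bounded_linear_snd_nth)

lemma lambda_form_eq: "lambda_form a = (\<lambda>p v. snd v $ 1 + a * (sin (snd p $ 2))\<^sup>2 * snd v $ 3)"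
  by (simp add: lambda_form_def u_coord_def[abs_def] theta_coord_def phi_coord_def[abs_def]
      ext_d0_bounded_linear bounded_linear_snd_nth)

lemma alpha_form_differentiable: "(\<lambda>q. alpha_form q w) differentiable at p"
proof -
  have "(\<lambda>q::coords. cos (snd q $ 2)) differentiable at p"
    unfolding differentiable_def
    by (rule exI, rule has_derivative_cos,
        rule bounded_linear_imp_has_derivative[OF bounded_linear_snd_nth])
  then show ?thesis
    by (simp add: alpha_form_eq)
qed

lemma pullback1_eta_form: "pullback1 (F_map a) eta_form = eta_form"
  by (simp add: pullback1_bounded_linear bounded_linear_F_map eta_form_eq F_map_components)

text \<open>The pullback has \<open>d\<phi>\<close> coefficient
  \<open>a / 2 * (1 - cos (2 * \<theta>))\<close>: the \<open>1\<close> comes from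
  \<open>d\<alpha>\<close>, the cosine from \<open>d\<gamma>\<close>.\<close>

lemma pullback1_alpha_form: "pullback1 (F_map a) alpha_form = lambda_form a"
  unfolding pullback1_bounded_linear[OF bounded_linear_F_map] alpha_form_eq lambda_form_eq
    F_map_components cos_double_sin
  by (simp add: algebra_simps)

text \<open>\<open>eta_form\<close> enters only through the wedge and is never differentiated, so
  the chain rule is applied to \<open>alpha_form\<close> alone.\<close>

lemma pullback2_omega_U2: "pullback2 (F_map a) omega_U2 = omega_Kerr a"
proof (intro ext)
  fix p v w
  have "pullback2 (F_map a) omega_U2 p v w
      = pullback2 (F_map a) (ext_d1 alpha_form) p v w
        + pullback2 (F_map a) (wedge alpha_form eta_form) p v w"
    by (simp add: pullback2_def omega_U2_def)
  also have "\<dots> = omega_Kerr a p v w"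
    by (simp add: pullback2_ext_d1 bounded_linear_F_map alpha_form_differentiable pullback2_wedge
        pullback1_alpha_form pullback1_eta_form omega_Kerr_def)
  finally show "pullback2 (F_map a) omega_U2 p v w = omega_Kerr a p v w" .
qed

theorem mainTheorem1:
  fixes a :: real
  assumes "a > 0"
  shows "(\<forall>p\<in>coord_domain. lambda_form a p = pullback1 (F_map a) alpha_form p)
       \<and> (\<forall>p\<in>coord_domain. omega_Kerr a p = pullback2 (F_map a) omega_U2 p)"
  by (simp add: pullback1_alpha_form pullback2_omega_U2)

end
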